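(* Every randomized one-pass streaming algorithm with constant error probability in the edge-arrival model that computes a maximal independent set of its $n$-vertex input graph requires $\Omega(n^2)$ space.
   Context: In the edge-arrival streaming model, the input graph $G=(V,E)$ on a predetermined vertex set $V$ with $|V|=n$ is given as a sequence of its edges $\langle e_1,\dots,e_m\rangle$ in arbitrary order, and the algorithm reads the sequence once. An independent set is a set $U\subseteq V$ containing no edge of $G$; it is maximal if no independent set contains it as a proper subset. *)

theory Defs
  imports "HOL-Probability.Probability_Mass_Function" "HOL-Library.Landau_Symbols"
begin

definition simple_graph :: "'v set \<Rightarrow> 'v set set \<Rightarrow> bool" where
  "simple_graph V E \<longleftrightarrow> (\<forall>e\<in>E. e \<subseteq> V \<and> card e = 2)"

definition independent_set :: "'v set \<Rightarrow> 'v set set \<Rightarrow> 'v set \<Rightarrow> bool" where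
  "independent_set V E U \<longleftrightarrow> U \<subseteq> V \<and> (\<forall>e\<in>E. \<not> e \<subseteq> U)"

definition maximal_independent_set :: "'v set \<Rightarrow> 'v set set \<Rightarrow> 'v set \<Rightarrow> bool" where
  "maximal_independent_set V E U \<longleftrightarrow>
     independent_set V E U \<and> (\<nexists>W. independent_set V E W \<and> U \<subset> W)"

definition edge_stream :: "'v set \<Rightarrow> 'v set set \<Rightarrow> 'v set list \<Rightarrow> bool" where
  "edge_stream V E es \<longleftrightarrow> simple_graph V E \<and> distinct es \<and> set es = E"

text \<open>
  A deterministic one-pass algorithm whose memory content is a bit string. The argument of type
  \<^typ>\<open>nat\<close> of \<open>alg_step\<close> is the position of the current edge in the stream. A randomized
  algorithm is a probability distribution over deterministic ones; the dependence on the position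
  is what lets such a distribution model fresh coin tosses at every update. Random bits and the
  position are thus available without being charged to the memory, so that the model subsumes
  those in which they have to be stored.
\<close>

record 'v stream_alg =
  alg_init :: "bool list"
  alg_step :: "nat \<Rightarrow> 'v set \<Rightarrow> bool list \<Rightarrow> bool list"
  alg_output :: "bool list \<Rightarrow> 'v set"

type_synonym 'v rand_stream_alg = "'v stream_alg pmf"

primrec run_from :: "'v stream_alg \<Rightarrow> nat \<Rightarrow> bool list \<Rightarrow> 'v set list \<Rightarrow> bool list" where
  "run_from D i \<sigma> [] = \<sigma>"
| "run_from D i \<sigma> (e # es) = run_from D (Suc i) (alg_step D i e \<sigma>) es"

definition final_memory :: "'v stream_alg \<Rightarrow> 'v set list \<Rightarrow> bool list" where
  "final_memory D es = run_from D 0 (alg_init D) es"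

definition computes_mis :: "'v set \<Rightarrow> real \<Rightarrow> 'v rand_stream_alg \<Rightarrow> bool" where
  "computes_mis V \<delta> A \<longleftrightarrow>
     (\<forall>E es. edge_stream V E es \<longrightarrow>
        measure_pmf.prob A
          {D. \<not> maximal_independent_set V E (alg_output D (final_memory D es))} \<le> \<delta>)"

text \<open>
  Worst case over inputs and random choices. Memory contents at intermediate times are covered,
  since every prefix of an edge stream is itself an edge stream (of a subgraph).
\<close>

definition uses_space :: "'v set \<Rightarrow> nat \<Rightarrow> 'v rand_stream_alg \<Rightarrow> bool" where
  "uses_space V s A \<longleftrightarrow>
     (\<forall>D\<in>set_pmf A. \<forall>E es. edge_stream V E es \<longrightarrow> length (final_memory D es) \<le> s)"

end

theory Submission imports Defs begin

text \<open>
  Reduction from the one-way communication problem INDEX over the alphabet of subsets of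
  \<open>{..<k}\<close>. Alice encodes a word \<open>X\<close> with \<open>N\<^sup>2\<close> letters into \<open>k\<close> disjoint bipartite graphs: the
  letter at \<open>t = (a, b)\<close> says in which of them the \<open>a\<close>-th left vertex is joined to the \<open>b\<close>-th
  right vertex. She inserts two copies of this graph. Bob, who wants the letter at \<open>t\<close>, joins
  every vertex of the first copy not associated with \<open>t\<close> to every such vertex of the second. A
  maximal independent set \<open>U\<close> then misses these vertices in one of the copies, and in that copy
  a pair associated with \<open>t\<close> is an edge iff it is not contained in \<open>U\<close>; so \<open>U\<close> reveals the letter.

  A fixed message makes Bob guess each letter of a uniformly random word independently with
  probability \<open>2\<^sup>-\<^sup>k\<close>. Bounding the exponential moment of the number of correct guesses and summing
  over all messages shows that \<open>r\<close>-bit messages give at most about \<open>(r + N\<^sup>2) / k\<close> correct letters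
  on average. The success probability \<open>1 - \<delta>\<close> may be arbitrarily small, which is why the alphabet
  has to be large: \<open>k\<close> is chosen with \<open>k (1 - \<delta>) \<ge> 3\<close>.
\<close>

lemma run_from_append:
  "run_from D i m (xs @ ys) = run_from D (i + length xs) (run_from D i m xs) ys"
  by (induction xs arbitrary: i m) auto

section \<open>Counting correct guesses in INDEX\<close>

text \<open>The weight is a product over positions, so the sum factors. Each factor is at most
  \<open>card Q\<close> for the letter \<open>g t\<close> plus 1 for every letter of
  \<open>Q\<close>.\<close>

lemma sum_power_agreements_le:
  fixes g :: "'p \<Rightarrow> 'q"
  assumes "finite P" and "finite Q"
  shows "(\<Sum>X\<in>P \<rightarrow>\<^sub>E Q. card Q ^ card {t\<in>P. X t = g t}) \<le> (2 * card Q) ^ card P"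
proof -
  let ?w = "\<lambda>t y. if y = g t then card Q else 1"
  have "card Q ^ card {t\<in>P. X t = g t} = (\<Prod>t\<in>P. ?w t (X t))" for X
    using assms(1) by (simp add: prod.If_cases Int_def)
  then have "(\<Sum>X\<in>P \<rightarrow>\<^sub>E Q. card Q ^ card {t\<in>P. X t = g t}) = (\<Prod>t\<in>P. \<Sum>y\<in>Q. ?w t y)"
    using assms by (simp add: prod_sum_PiE)
  also have "\<dots> \<le> (\<Prod>t\<in>P. 2 * card Q)"
  proof (rule prod_mono, intro conjI)
    fix t
    have "(\<Sum>y\<in>Q. ?w t y) \<le> (\<Sum>y\<in>Q. (if y = g t then card Q else 0) + 1)"
      by (intro sum_mono) auto
    also have "\<dots> \<le> 2 * card Q"
      unfolding sum.distrib using assms(2) by simp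
    finally show "(\<Sum>y\<in>Q. ?w t y) \<le> 2 * card Q" .
  qed simp
  finally show ?thesis by simp
qed

text \<open>
  The inequality \<open>y \<le> 2\<^sup>y\<close> for \<open>y = x - a\<close>, multiplied by \<open>2\<^sup>a\<close>. It replaces
  Jensen's inequality when passing from exponential moments to expectations.
\<close>

lemma mult_power2_le:
  fixes a x :: nat
  shows "x * 2 ^ a \<le> a * 2 ^ a + 2 ^ x"
proof (cases "x \<le> a")
  case True
  then show ?thesis by (simp add: trans_le_add1)
next
  case False
  then obtain y where x: "x = a + y" by (metis le_add_diff_inverse nat_le_linear)
  have "y * 2 ^ a \<le> 2 ^ y * 2 ^ a"
    by (intro mult_right_mono) (auto intro: less_imp_le)
  then show ?thesis by (simp add: x power_add algebra_simps)
qed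

lemma index_agreements_le:
  fixes msg :: "('p \<Rightarrow> 'q) \<Rightarrow> 'm" and dec :: "'m \<Rightarrow> 'p \<Rightarrow> 'q"
  assumes "finite P" and "finite Q" and Q: "card Q = 2 ^ k"
    and "finite S" and S: "card S \<le> 2 ^ r" and msg: "\<And>X. X \<in> P \<rightarrow>\<^sub>E Q \<Longrightarrow> msg X \<in> S"
  shows "(\<Sum>X\<in>P \<rightarrow>\<^sub>E Q. k * card {t\<in>P. X t = dec (msg X) t})
           \<le> (r + card P + 1) * card (P \<rightarrow>\<^sub>E Q)"
proof -
  let ?F = "P \<rightarrow>\<^sub>E Q" and ?a = "r + card P"
  let ?c = "\<lambda>m X. card {t\<in>P. X t = dec m t}"
  have "finite ?F" using assms by (simp add: finite_PiE)
  have cF: "card ?F = card Q ^ card P" using assms by (simp add: card_PiE)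
  \<comment> \<open>Replacing the actual message by all of \<open>S\<close> makes the guess
    independent of \<open>X\<close>, at the cost of a factor \<open>card S\<close>.\<close>
  have "(\<Sum>X\<in>?F. card Q ^ ?c (msg X) X) \<le> (\<Sum>X\<in>?F. \<Sum>m\<in>S. card Q ^ ?c m X)"
    using \<open>finite S\<close> msg by (intro sum_mono member_le_sum) auto
  also have "\<dots> = (\<Sum>m\<in>S. \<Sum>X\<in>?F. card Q ^ ?c m X)" by (rule sum.swap)
  also have "\<dots> \<le> (\<Sum>m\<in>S. (2 * card Q) ^ card P)"
    by (intro sum_mono sum_power_agreements_le assms)
  also have "\<dots> \<le> 2 ^ r * (2 * card Q) ^ card P"
    using S by simp
  also have "\<dots> = 2 ^ ?a * card ?F"
    by (simp add: cF power_add power_mult_distrib)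
  finally have exp_moment: "(\<Sum>X\<in>?F. card Q ^ ?c (msg X) X) \<le> 2 ^ ?a * card ?F" .
  have "(\<Sum>X\<in>?F. k * ?c (msg X) X) * 2 ^ ?a = (\<Sum>X\<in>?F. k * ?c (msg X) X * 2 ^ ?a)"
    by (simp add: sum_distrib_right)
  also have "\<dots> \<le> (\<Sum>X\<in>?F. ?a * 2 ^ ?a + card Q ^ ?c (msg X) X)"
    unfolding Q power_mult[symmetric] by (intro sum_mono mult_power2_le)
  also have "\<dots> \<le> (?a + 1) * card ?F * 2 ^ ?a"
    using exp_moment by (simp add: sum.distrib algebra_simps)
  finally show ?thesis by simp
qed

lemma card_lists_length_atMost_bool:
  "card {xs :: bool list. length xs \<le> s} \<le> 2 ^ (s + 1)"
proof -
  have "card {xs :: bool list. length xs \<le> s} = (\<Sum>i\<le>s. 2 ^ i)"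
    using card_lists_length_le[of "UNIV :: bool set" s] by simp
  also have "\<dots> \<le> 2 ^ (s + 1)"
    by (induction s) auto
  finally show ?thesis .
qed

section \<open>Decoding a letter from a maximal independent set\<close>

lemma maximal_independent_set_neighbour:
  assumes "maximal_independent_set V E U" and "v \<in> V" and "v \<notin> U"
    and "\<And>e. e \<in> E \<Longrightarrow> card e = 2"
  obtains u where "u \<in> U" and "{u, v} \<in> E"
proof -
  have U: "independent_set V E U" and "\<not> independent_set V E (insert v U)"
    using assms unfolding maximal_independent_set_def by auto
  then obtain e where e: "e \<in> E" "e \<subseteq> insert v U" "\<not> e \<subseteq> U"
    using assms(2) unfolding independent_set_def by auto
  then have "v \<in> e" by auto
  then obtain u where "e = {u, v}" "u \<noteq> v"
    using assms(4)[OF e(1)] by (auto simp: card_2_iff)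
  then show thesis using e that by auto
qed

text \<open>
  Vertex \<open>(c, i, h, x)\<close> is the \<open>x\<close>-th vertex on side \<open>h\<close> of the \<open>i\<close>-th bipartite graph in
  copy \<open>c\<close>; \<open>\<phi>\<close> places these vertices inside \<open>V\<close>.
\<close>

locale index_gadget =
  fixes V :: "'v set" and k N :: nat and \<phi> :: "bool \<times> nat \<times> bool \<times> nat \<Rightarrow> 'v"
  assumes inj: "inj_on \<phi> (UNIV \<times> {..<k} \<times> UNIV \<times> {..<N})"
    and into: "\<phi> ` (UNIV \<times> {..<k} \<times> UNIV \<times> {..<N}) \<subseteq> V"
    and finite_V: "finite V"
begin

definition alice :: "(nat \<times> nat \<Rightarrow> nat set) \<Rightarrow> 'v set set" where
  "alice X = {{\<phi> (c, i, False, a), \<phi> (c, i, True, b)} |c i a b.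
     i < k \<and> a < N \<and> b < N \<and> i \<in> X (a, b)}"

definition rest :: "nat \<times> nat \<Rightarrow> bool \<Rightarrow> 'v set" where
  "rest t c = {\<phi> (c, i, h, x) |i h x. i < k \<and> x < N \<and> x \<noteq> (if h then snd t else fst t)}"

definition bob :: "nat \<times> nat \<Rightarrow> 'v set set" where
  "bob t = {{u, v} |u v. u \<in> rest t False \<and> v \<in> rest t True}"

text \<open>The truth value \<open>c\<close> doubles as the name of the copy to inspect: if
  \<open>U\<close> meets \<open>rest t False\<close>, Bob's edges make it miss
  \<open>rest t True\<close>; otherwise it misses \<open>rest t False\<close> itself.\<close>

definition decode :: "nat \<times> nat \<Rightarrow> 'v set \<Rightarrow> nat set" where
  "decode t U = (let c = (U \<inter> rest t False \<noteq> {}) in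
     {i. i < k \<and> \<not> (\<phi> (c, i, False, fst t) \<in> U \<and> \<phi> (c, i, True, snd t) \<in> U)})"

lemma phi_eq_iff:
  assumes "i < k" "x < N" "j < k" "y < N"
  shows "\<phi> (c, i, h, x) = \<phi> (d, j, h', y) \<longleftrightarrow> c = d \<and> i = j \<and> h = h' \<and> x = y"
  using inj_on_eq_iff[OF inj, of "(c, i, h, x)" "(d, j, h', y)"] assms by simp

lemma phi_in: "i < k \<Longrightarrow> x < N \<Longrightarrow> \<phi> (c, i, h, x) \<in> V"
  using into by auto

lemma restI:
  "i < k \<Longrightarrow> x < N \<Longrightarrow> x \<noteq> (if h then snd t else fst t) \<Longrightarrow> \<phi> (c, i, h, x) \<in> rest t c"
  unfolding rest_def by blast

lemma simple_graph_alice: "simple_graph V (alice X)"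
  unfolding simple_graph_def alice_def by (auto simp: phi_in phi_eq_iff card_insert_if)

lemma simple_graph_bob: "simple_graph V (bob t)"
  unfolding simple_graph_def bob_def rest_def by (auto simp: phi_in phi_eq_iff card_insert_if)

lemma finite_if_simple_graph: "simple_graph V E \<Longrightarrow> finite E"
  using finite_V finite_subset[of E "Pow V"] unfolding simple_graph_def by auto

text \<open>Alice's edges stay within one copy, Bob's run between the copies. Hence the concatenated
  stream repeats no edge.\<close>

lemma alice_bob_disjoint: "alice X \<inter> bob t = {}"
  unfolding alice_def bob_def rest_def by (auto simp: doubleton_eq_iff phi_eq_iff)

lemma card_alice_le: "card (alice X) \<le> 2 * k * N\<^sup>2"
proof -
  let ?I = "(UNIV :: bool set) \<times> {..<k} \<times> {..<N} \<times> {..<N}"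
  have "alice X \<subseteq> (\<lambda>(c, i, a, b). {\<phi> (c, i, False, a), \<phi> (c, i, True, b)}) ` ?I"
    unfolding alice_def by force
  then have "card (alice X) \<le> card ?I"
    by (rule surj_card_le[rotated]) simp
  then show ?thesis by (simp add: card_cartesian_product power2_eq_square)
qed

lemma decode_correct:
  assumes mis: "maximal_independent_set V (alice X \<union> bob t) U"
    and X: "X \<in> {..<N} \<times> {..<N} \<rightarrow>\<^sub>E Pow {..<k}" and t: "t \<in> {..<N} \<times> {..<N}"
  shows "decode t U = X t"
proof -
  obtain a b where tab: "t = (a, b)" and ab: "a < N" "b < N" using t by auto
  have ind: "\<not> e \<subseteq> U" if "e \<in> alice X \<union> bob t" for e
    using mis that unfolding maximal_independent_set_def independent_set_def by auto
  have two: "card e = 2" if "e \<in> alice X \<union> bob t" for e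
    using that simple_graph_alice simple_graph_bob unfolding simple_graph_def by blast
  define c where "c = (U \<inter> rest t False \<noteq> {})"
  have empty: "U \<inter> rest t c = {}"
  proof (cases "U \<inter> rest t False = {}")
    case False
    then obtain u where "u \<in> U" "u \<in> rest t False" by auto
    then have "v \<notin> U" if "v \<in> rest t True" for v
      using ind[of "{u, v}"] that unfolding bob_def by auto
    then show ?thesis using False by (auto simp: c_def)
  qed (simp add: c_def)
  \<comment> \<open>A vertex associated with \<open>t\<close> has only Alice's edges. As
    \<open>i\<close> is not in \<open>X t\<close>, all its neighbours lie in
    \<open>rest t c\<close>, which \<open>U\<close> misses, so maximality puts it into
    \<open>U\<close>.\<close>
  have joined: "\<phi> (c, i, h, if h then b else a) \<in> U" if i: "i < k" "i \<notin> X t" for i h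
  proof (rule ccontr)
    let ?v = "\<phi> (c, i, h, if h then b else a)"
    assume "?v \<notin> U"
    moreover have "?v \<in> V" using i ab by (simp add: phi_in)
    ultimately obtain u where u: "u \<in> U" "{u, ?v} \<in> alice X \<union> bob t"
      using maximal_independent_set_neighbour[OF mis _ _ two] by blast
    have "?v \<notin> rest t d" for d
      unfolding rest_def using i ab by (auto simp: phi_eq_iff tab)
    then have "{u, ?v} \<notin> bob t"
      unfolding bob_def by (auto simp: doubleton_eq_iff)
    then have "{u, ?v} \<in> alice X" using u by auto
    then obtain d j a' b' where e: "{u, ?v} = {\<phi> (d, j, False, a'), \<phi> (d, j, True, b')}"
      and j: "j < k" "a' < N" "b' < N" "j \<in> X (a', b')"
      unfolding alice_def by blast
    have "u \<in> rest t c"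
    proof (cases h)
      case True
      then have "u = \<phi> (c, i, False, a')" "b' = b" "j = i"
        using e i ab j by (auto simp: doubleton_eq_iff phi_eq_iff)
      moreover from this have "a' \<noteq> a" using i j tab by auto
      ultimately show ?thesis using i j tab by (simp add: restI)
    next
      case False
      then have "u = \<phi> (c, i, True, b')" "a' = a" "j = i"
        using e i ab j by (auto simp: doubleton_eq_iff phi_eq_iff)
      moreover from this have "b' \<noteq> b" using i j tab by auto
      ultimately show ?thesis using i j tab by (simp add: restI)
    qed
    then show False using u empty by auto
  qed
  have split: "\<not> (\<phi> (c, i, False, a) \<in> U \<and> \<phi> (c, i, True, b) \<in> U)" if "i \<in> X t" for i
  proof -
    have "i < k" using X t that by (auto simp: PiE_iff)
    then have "{\<phi> (c, i, False, a), \<phi> (c, i, True, b)} \<in> alice X"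
      unfolding alice_def using ab that tab by blast
    then show ?thesis using ind by auto
  qed
  have "X t \<subseteq> {..<k}" using X t by (auto simp: PiE_iff)
  then show ?thesis
    unfolding decode_def Let_def c_def[symmetric]
    using joined[of _ False] joined[of _ True] split by (auto simp: tab)
qed

section \<open>From streaming algorithms to messages\<close>

text \<open>Each letter of each word is recovered with probability at least
  \<open>1 - \<delta>\<close>, while the INDEX bound limits the recovered letters for every
  deterministic algorithm in the support. Taking expectations compares the two.\<close>

lemma space_lower_bound:
  assumes mis: "computes_mis V \<delta> A" and space: "uses_space V s A"
  shows "real k * (1 - \<delta>) * real (N\<^sup>2) \<le> real (s + 2 * N\<^sup>2 + 2 * k + 2)"
proof -
  define P where "P = {..<N} \<times> {..<N}"
  define Q where "Q = Pow {..<k}"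
  define F where "F = P \<rightarrow>\<^sub>E Q"
  \<comment> \<open>This is \<open>r + card P + 1\<close> for messages of
    \<open>r = 2 * k + N\<^sup>2 + s + 1\<close> bits.\<close>
  define B where "B = s + 2 * N\<^sup>2 + 2 * k + 2"
  have PQ: "finite P" "finite Q" "card P = N\<^sup>2" "card Q = 2 ^ k"
    by (auto simp: P_def Q_def card_Pow power2_eq_square)
  then have F: "finite F" "card F > 0"
    by (auto simp: F_def finite_PiE card_PiE)
  have "\<exists>xs. distinct xs \<and> set xs = alice X" for X
    using finite_distinct_list[OF finite_if_simple_graph[OF simple_graph_alice]] by blast
  then obtain xs where xs: "\<And>X. distinct (xs X)" "\<And>X. set (xs X) = alice X" by metis
  have "\<exists>ys. distinct ys \<and> set ys = bob t" for t
    using finite_distinct_list[OF finite_if_simple_graph[OF simple_graph_bob]] by blast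
  then obtain ys where ys: "\<And>t. distinct (ys t)" "\<And>t. set (ys t) = bob t" by metis
  have streams: "edge_stream V (alice X) (xs X)"
      "edge_stream V (alice X \<union> bob t) (xs X @ ys t)" for X t
    using xs ys alice_bob_disjoint[of X t] simple_graph_alice[of X] simple_graph_bob[of t]
    by (auto simp: edge_stream_def simple_graph_def ball_Un)
  define good where "good D X t \<longleftrightarrow> maximal_independent_set V (alice X \<union> bob t)
      (alg_output D (final_memory D (xs X @ ys t)))" for D X t
  have pointwise: "(\<Sum>X\<in>F. \<Sum>t\<in>P. indicator {D. good D X t} D) * real k \<le> real (B * card F)"
    if D: "D \<in> set_pmf A" for D
  proof -
    \<comment> \<open>The number of Alice's edges is part of the message because the transition function may
      depend on the position in the stream.\<close>
    define msg where "msg X = (length (xs X), final_memory D (xs X))" for X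
    define dec where
      "dec m t = decode t (alg_output D (run_from D (fst m) (snd m) (ys t)))" for m t
    define S where "S = {..2 * k * N\<^sup>2} \<times> {\<sigma> :: bool list. length \<sigma> \<le> s}"
    have "finite {\<sigma> :: bool list. length \<sigma> \<le> s}"
      using finite_lists_length_le[of "UNIV :: bool set" s] by simp
    then have "finite S" by (simp add: S_def)
    \<comment> \<open>Crude count of the stream lengths: the extra \<open>N\<^sup>2\<close> bits are
      affordable since \<open>k\<close> will be large.\<close>
    have "2 * k * N\<^sup>2 + 1 \<le> Suc (2 * k) * Suc (N\<^sup>2)" by simp
    also have "\<dots> \<le> 2 ^ (2 * k) * 2 ^ (N\<^sup>2)"
      by (intro mult_mono) (auto simp: Suc_le_eq)
    finally have "card S \<le> (2 ^ (2 * k) * 2 ^ (N\<^sup>2)) * 2 ^ (s + 1)"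
      unfolding S_def card_cartesian_product
      by (intro mult_mono card_lists_length_atMost_bool) auto
    then have "card S \<le> 2 ^ (2 * k + N\<^sup>2 + s + 1)" by (simp add: power_add mult_ac)
    moreover have "msg X \<in> S" for X
    proof -
      have "length (xs X) \<le> 2 * k * N\<^sup>2"
        using card_alice_le[of X] xs distinct_card by metis
      then show ?thesis
        using space D streams(1) by (auto simp: S_def msg_def uses_space_def)
    qed
    ultimately have le: "(\<Sum>X\<in>F. k * card {t\<in>P. X t = dec (msg X) t}) \<le> B * card F"
      using index_agreements_le[OF PQ(1,2,4) \<open>finite S\<close>, of "2 * k + N\<^sup>2 + s + 1" msg dec]
      by (simp add: F_def[symmetric] B_def PQ(3) algebra_simps)
    have "card {t\<in>P. good D X t} \<le> card {t\<in>P. X t = dec (msg X) t}" if "X \<in> F" for X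
    proof (rule card_mono)
      show "{t\<in>P. good D X t} \<subseteq> {t\<in>P. X t = dec (msg X) t}"
        using decode_correct[of X] that
        by (auto simp: good_def F_def P_def Q_def dec_def msg_def final_memory_def run_from_append)
    qed (use PQ in simp)
    then have "(\<Sum>X\<in>F. k * card {t\<in>P. good D X t}) \<le> B * card F"
      by (intro order_trans[OF sum_mono le]) simp
    moreover have "(\<Sum>t\<in>P. indicator {D. good D X t} D) = real (card {t\<in>P. good D X t})" for X
      using PQ(1) by (simp add: indicator_def sum.If_cases Int_def)
    ultimately show ?thesis
      by (simp add: sum_distrib_right mult.commute[of "real k"] flip: of_nat_mult of_nat_sum)
        (simp add: mult.commute)
  qed
  have prob: "1 - \<delta> \<le> measure_pmf.prob A {D. good D X t}" for X t
  proof -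
    have "measure_pmf.prob A {D. \<not> good D X t} \<le> \<delta>"
      using mis streams(2) unfolding computes_mis_def good_def by blast
    then show ?thesis
      using measure_pmf.prob_compl[of "{D. good D X t}" A] by (simp add: Collect_neg_eq Compl_eq_Diff_UNIV)
  qed
  have integrable: "integrable (measure_pmf A) (indicator S :: _ \<Rightarrow> real)" for S
    by (rule measure_pmf.integrable_const_bound[where B = 1]) auto
  have "(\<Sum>X\<in>F. \<Sum>t\<in>P. 1 - \<delta>) * real k
      \<le> (\<Sum>X\<in>F. \<Sum>t\<in>P. measure_pmf.prob A {D. good D X t}) * real k"
    by (intro mult_right_mono sum_mono prob) simp
  also have "\<dots> = measure_pmf.expectation A
      (\<lambda>D. (\<Sum>X\<in>F. \<Sum>t\<in>P. indicator {D. good D X t} D) * real k)"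
    by (simp add: integrable)
  also have "\<dots> \<le> real (B * card F)"
    using pointwise by (intro measure_pmf.integral_le_const) (auto simp: AE_measure_pmf_iff integrable)
  finally have "real (card F) * (real k * (1 - \<delta>) * real (N\<^sup>2)) \<le> real (card F) * real B"
    by (simp add: PQ(3) algebra_simps)
  then show ?thesis using F(2) by (simp add: B_def)
qed

end

section \<open>Choice of parameters\<close>

lemma mis_space_lower_bound:
  fixes V :: "'v set"
  assumes "finite V" and "4 * k * N \<le> card V"
    and "computes_mis V \<delta> A" and "uses_space V s A"
  shows "real k * (1 - \<delta>) * real (N\<^sup>2) \<le> real (s + 2 * N\<^sup>2 + 2 * k + 2)"
proof -
  let ?W = "(UNIV :: bool set) \<times> {..<k} \<times> (UNIV :: bool set) \<times> {..<N}"
  have "card ?W \<le> card V" using assms(2) by (simp add: card_cartesian_product)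
  then obtain \<phi> :: "_ \<Rightarrow> 'v" where "\<phi> ` ?W \<subseteq> V" "inj_on \<phi> ?W"
    using card_le_inj[of ?W V] assms(1) by auto
  then interpret index_gadget V k N \<phi>
    using assms(1) by unfold_locales
  show ?thesis using assms(3,4) by (rule space_lower_bound)
qed

theorem theorem3:
  fixes A :: "nat \<Rightarrow> nat rand_stream_alg" and s :: "nat \<Rightarrow> nat" and \<delta> :: real
  assumes "\<delta> < 1"
    and "\<And>n. computes_mis {..<n} \<delta> (A n)"
    and "\<And>n. uses_space {..<n} (s n) (A n)"
  shows "(\<lambda>n. real (s n)) \<in> \<Omega>(\<lambda>n. real n ^ 2)"
proof -
  \<comment> \<open>The factor 3 beats \<open>2 * N\<^sup>2\<close> on the right-hand side and
    leaves one \<open>N\<^sup>2\<close>.\<close>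
  obtain k :: nat where "3 / (1 - \<delta>) < real k" using reals_Archimedean2 by blast
  then have k3: "3 \<le> real k * (1 - \<delta>)" using assms(1) by (simp add: field_simps)
  then have "k > 0" by (cases k) auto
  \<comment> \<open>For \<open>n \<ge> 8 * k\<close> rounding gives
    \<open>N \<ge> n / (8 * k)\<close>, so \<open>N\<^sup>2\<close> is at least
    \<open>2 * c * n\<^sup>2\<close>; one half of this absorbs \<open>2 * k + 2\<close>.\<close>
  define c where "c = 1 / (128 * real k ^ 2)"
  have "c > 0" using \<open>k > 0\<close> by (simp add: c_def)
  have "c * real n ^ 2 \<le> real (s n)" if n: "n \<ge> 128 * k\<^sup>2 * (2 * k + 2)" for n
  proof -
    define N where "N = n div (4 * k)"
    have "3 * real (N\<^sup>2) \<le> real k * (1 - \<delta>) * real (N\<^sup>2)"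
      using k3 by (intro mult_right_mono) auto
    also have "\<dots> \<le> real (s n + 2 * N\<^sup>2 + 2 * k + 2)"
      by (rule mis_space_lower_bound[OF _ _ assms(2,3)]) (simp_all add: N_def)
    finally have s: "real N ^ 2 \<le> real (s n) + real (2 * k + 2)" by simp
    have "8 * k \<le> 128 * k\<^sup>2 * (2 * k + 2)"
      using \<open>k > 0\<close> by (simp add: power2_eq_square trans_le_add1)
    then have "8 * k \<le> n" using n by linarith
    moreover have "n < 4 * k * N + 4 * k"
      using \<open>k > 0\<close> mod_less_divisor[of "4 * k" n] mult_div_mod_eq[of "4 * k" n]
      unfolding N_def by linarith
    ultimately have "n \<le> 8 * k * N" by linarith
    then have "real n \<le> real (8 * k * N)" by (simp only: of_nat_le_iff)
    then have "real n ^ 2 \<le> (8 * real k * real N) ^ 2" by (intro power_mono) auto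
    then have "2 * c * real n ^ 2 \<le> real N ^ 2"
      using \<open>k > 0\<close> by (simp add: c_def field_simps)
    moreover have "real (2 * k + 2) \<le> c * real n ^ 2"
    proof -
      have "128 * k\<^sup>2 * (2 * k + 2) \<le> n\<^sup>2"
        using le_trans[OF n le_square[of n]] by (simp only: power2_eq_square)
      then have "real (128 * k\<^sup>2 * (2 * k + 2)) \<le> real (n\<^sup>2)" by (simp only: of_nat_le_iff)
      then show ?thesis using \<open>k > 0\<close> by (simp add: c_def field_simps)
    qed
    ultimately show ?thesis using s by linarith
  qed
  then have "\<forall>\<^sub>F n in at_top. c * norm (real n ^ 2) \<le> norm (real (s n))"
    unfolding eventually_at_top_linorder by auto
  then show ?thesis using \<open>c > 0\<close> by (intro landau_omega.bigI) auto
qed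

end
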